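(* Consider the two-sector growth model described in the context, and let $(k,h,c,u,v)$ be a trajectory of its dynamical system. Suppose that there is $t_*$ such that $r_u=r_v=0$ for all $t\ge t_*$ (i.e. $u$ and $v$ are constant on $[t_*,\infty)$). Then for $t\ge t_*$ the system is on the unique balanced growth path. Write $u_*,v_*,w_*,c_*,k_*$ for the values of the variables at $t=t_*$, and let $P_1,P_2$ below be evaluated at $w=w_*$. Then the following hold. (i) For $t\ge t_*$, the variables $k,h,c,y_1,y_2$ all grow at the same constant rate $r_*$, where $$r_*=\frac1\varepsilon\left[\alpha_1A_1w_*^{\psi_1-1}P_1^{\frac1{\psi_1}-1}-\rho-\delta_k\right].$$ (ii) $w_*$ is the unique solution $w\in(0,\infty)$ of the equation $$P(w)=\alpha_1A_1w^{\psi_1-1}P_1(w)^{\frac1{\psi_1}-1}-(1-\alpha_2)A_2P_2(w)^{\frac1{\psi_2}-1}-(\delta_k-\delta_h)=0 .$$ (iii) $u_*\in[0,1]$, $v_*\in[0,1]$, and with $\tau_0=w_*^{\frac{\psi_1-\psi_2}{1-\psi_2}}\theta^{\frac1{1-\psi_2}}$, $$u_*=1-\frac{r_*+\delta_h}{A_2P_2^{1/\psi_2}},\qquad v_*=\frac{\tau_0u_*}{1+(\tau_0-1)u_*}.$$ (iv) $$\frac{c_*}{k_*}=\frac1\varepsilon\left[A_1w_*^{-1}P_\varepsilon P_1^{\frac1{\psi_1}-1}+\rho-\delta_k(\varepsilon-1)\right],\qquad P_\varepsilon=\alpha_1(\varepsilon v_*-1)w_*^{\psi_1}+\varepsilon(1-\alpha_1)v_*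 .$$
   Context: Parameters: $A_1,A_2>0$; $\alpha_1,\alpha_2\in(0,1)$; $\psi_1,\psi_2<1$, both nonzero, with $\psi_1\ne\psi_2$ ($\psi_i=(\sigma_i-1)/\sigma_i$, where $\sigma_i>0$ is the elasticity of substitution of sector $i$); discount rate $\rho>0$; depreciation rates $\delta_k,\delta_h$; and $\varepsilon>1$. Model: maximize $\int_0^\infty\frac{c^{1-\varepsilon}-1}{1-\varepsilon}e^{-\rho t}dt$ subject to $\dot k=y_1-c-\delta_kk$, $\dot h=y_2-\delta_hh$, $k(0)=k_0$, $h(0)=h_0$ given. Here $k$ is physical capital, $h$ is human capital, and $c$ is consumption. The fractions of physical and human capital allocated to the goods sector are $v$ and $u$ respectively. The outputs are $$y_1=A_1[\alpha_1(kv)^{\psi_1}+(1-\alpha_1)(hu)^{\psi_1}]^{1/\psi_1},\quad y_2=A_2\{\alpha_2[k(1-v)]^{\psi_2}+(1-\alpha_2)[h(1-u)]^{\psi_2}\}^{1/\psi_2}.$$ Notation: $r_x=\dot x/x$ is the growth rate of $x$; $z=k/h$; $w=\frac vu z=\frac{kv}{hu}$; $\tau=\frac{v(1-u)}{u(1-v)}$; $\theta=\frac{\alpha_1(1-\alpha_2)}{\alpha_2(1-\alpha_1)}$; $$P_1(w)=\alpha_1w^{\psi_1}+1-\alpha_1,\qquad P_2(w)=\alpha_2\theta^{-\frac{\psi_2}{1-\psi_2}}w^{\frac{\psi_2(1-\psi_1)}{1-\psi_2}}+1-\alpha_2,$$ $$D=A_2(1-u)P_2^{1/\psi_2}-A_1vw^{-1}P_1^{1/\psi_1}+\delta_k-\delta_h,$$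 $$P=\alpha_1A_1w^{\psi_1-1}P_1^{\frac1{\psi_1}-1}-(1-\alpha_2)A_2P_2^{\frac1{\psi_2}-1}-(\delta_k-\delta_h),$$ $$T=\alpha_1(1-\alpha_2)w^{\psi_1}-\alpha_2(1-\alpha_1)\theta^{-\frac{\psi_2}{1-\psi_2}}w^{\frac{\psi_2(1-\psi_1)}{1-\psi_2}},$$ $$G_1=(\psi_1-\psi_2)u+1-\psi_1,\quad G_2=(\psi_1-\psi_2)v+1-\psi_1,\quad Q=P_1P_2,\quad R=(1-\psi_1)(1-\psi_2)T.$$ Dynamical system (obtained from the first-order conditions of the Hamiltonian). A trajectory has $k,h,c>0$ and interior fractions $u,v$, with all denominators below nonzero. It satisfies the static optimality condition $\theta w^{\psi_1-\psi_2}=\tau^{1-\psi_2}$, under which $y_1=A_1hu\,P_1^{1/\psi_1}$ and $y_2=A_2h(1-u)P_2^{1/\psi_2}$. It also satisfies the differential equations $$\frac{\dot k}k=A_1vw^{-1}P_1^{1/\psi_1}-\frac ck-\delta_k,\qquad \frac{\dot h}h=A_2P_2^{1/\psi_2}(1-u)-\delta_h,$$ $$\frac{\dot c}c=\frac1\varepsilon\left[\alpha_1A_1w^{\psi_1-1}P_1^{\frac1{\psi_1}-1}-\rho-\delta_k\right],$$ $$\frac{\dot u}u=\left[D+\frac ck+\frac{QG_2P}R\right]\frac{1-u}{u-v},\qquad \frac{\dot v}v=\left[D+\frac ck+\frac{QG_1P}R\right]\frac{1-v}{u-v}.$$ A balanced growth path is a trajectory along which $u,v$ are constant and $k,h,c,y_1,y_2$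 grow at constant rates. *)

theory Defs
  imports Complex_Main
begin

record params =
  A1 :: real
  A2 :: real
  \<alpha>1 :: real
  \<alpha>2 :: real
  \<psi>1 :: real
  \<psi>2 :: real
  \<rho> :: real
  \<delta>k :: real
  \<delta>h :: real
  \<epsilon> :: real

text \<open>No sign is imposed on the depreciation rates.\<close>

definition valid_params :: "params \<Rightarrow> bool" where
  "valid_params p \<longleftrightarrow>
     A1 p > 0 \<and> A2 p > 0 \<and>
     0 < \<alpha>1 p \<and> \<alpha>1 p < 1 \<and> 0 < \<alpha>2 p \<and> \<alpha>2 p < 1 \<and>
     \<psi>1 p < 1 \<and> \<psi>2 p < 1 \<and> \<psi>1 p \<noteq> 0 \<and> \<psi>2 p \<noteq> 0 \<and> \<psi>1 p \<noteq> \<psi>2 p \<and>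
     \<rho> p > 0 \<and> \<epsilon> p > 1"

definition y1 :: "params \<Rightarrow> real \<Rightarrow> real \<Rightarrow> real \<Rightarrow> real \<Rightarrow> real" where
  "y1 p k h u v =
     A1 p * (\<alpha>1 p * (k * v) powr \<psi>1 p + (1 - \<alpha>1 p) * (h * u) powr \<psi>1 p) powr (1 / \<psi>1 p)"

definition y2 :: "params \<Rightarrow> real \<Rightarrow> real \<Rightarrow> real \<Rightarrow> real \<Rightarrow> real" where
  "y2 p k h u v =
     A2 p * (\<alpha>2 p * (k * (1 - v)) powr \<psi>2 p
             + (1 - \<alpha>2 p) * (h * (1 - u)) powr \<psi>2 p) powr (1 / \<psi>2 p)"

definition w_of :: "real \<Rightarrow> real \<Rightarrow> real \<Rightarrow> real \<Rightarrow> real" where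
  "w_of k h u v = v / u * (k / h)"

definition \<tau>_of :: "real \<Rightarrow> real \<Rightarrow> real" where
  "\<tau>_of u v = v * (1 - u) / (u * (1 - v))"

definition \<theta> :: "params \<Rightarrow> real" where
  "\<theta> p = \<alpha>1 p * (1 - \<alpha>2 p) / (\<alpha>2 p * (1 - \<alpha>1 p))"

definition P1 :: "params \<Rightarrow> real \<Rightarrow> real" where
  "P1 p w = \<alpha>1 p * w powr \<psi>1 p + 1 - \<alpha>1 p"

definition P2 :: "params \<Rightarrow> real \<Rightarrow> real" where
  "P2 p w =
     \<alpha>2 p * \<theta> p powr (- (\<psi>2 p / (1 - \<psi>2 p)))
       * w powr (\<psi>2 p * (1 - \<psi>1 p) / (1 - \<psi>2 p)) + 1 - \<alpha>2 p"

definition D_fun :: "params \<Rightarrow> real \<Rightarrow> real \<Rightarrow> real \<Rightarrow> real" where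
  "D_fun p u v w =
     A2 p * (1 - u) * P2 p w powr (1 / \<psi>2 p)
     - A1 p * v * (1 / w) * P1 p w powr (1 / \<psi>1 p) + \<delta>k p - \<delta>h p"

definition P_fun :: "params \<Rightarrow> real \<Rightarrow> real" where
  "P_fun p w =
     \<alpha>1 p * A1 p * w powr (\<psi>1 p - 1) * P1 p w powr (1 / \<psi>1 p - 1)
     - (1 - \<alpha>2 p) * A2 p * P2 p w powr (1 / \<psi>2 p - 1) - (\<delta>k p - \<delta>h p)"

definition T_fun :: "params \<Rightarrow> real \<Rightarrow> real" where
  "T_fun p w =
     \<alpha>1 p * (1 - \<alpha>2 p) * w powr \<psi>1 p
     - \<alpha>2 p * (1 - \<alpha>1 p) * \<theta> p powr (- (\<psi>2 p / (1 - \<psi>2 p)))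
         * w powr (\<psi>2 p * (1 - \<psi>1 p) / (1 - \<psi>2 p))"

definition G1 :: "params \<Rightarrow> real \<Rightarrow> real" where
  "G1 p u = (\<psi>1 p - \<psi>2 p) * u + 1 - \<psi>1 p"

definition G2 :: "params \<Rightarrow> real \<Rightarrow> real" where
  "G2 p v = (\<psi>1 p - \<psi>2 p) * v + 1 - \<psi>1 p"

definition Q_fun :: "params \<Rightarrow> real \<Rightarrow> real" where
  "Q_fun p w = P1 p w * P2 p w"

definition R_fun :: "params \<Rightarrow> real \<Rightarrow> real" where
  "R_fun p w = (1 - \<psi>1 p) * (1 - \<psi>2 p) * T_fun p w"

text \<open>\<open>has_growth_rate x r t S\<close>: at time \<open>t\<close>, with time ranging over \<open>S\<close>, the quotient of the
  derivative of \<open>x\<close> by \<open>x\<close> exists and equals \<open>r\<close>.  At the left endpoint of a half-line \<open>S\<close> the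
  derivative is one-sided.\<close>

definition has_growth_rate :: "(real \<Rightarrow> real) \<Rightarrow> real \<Rightarrow> real \<Rightarrow> real set \<Rightarrow> bool" where
  "has_growth_rate x r t S \<longleftrightarrow>
     x t \<noteq> 0 \<and> (\<exists>d. (x has_real_derivative d) (at t within S) \<and> d / x t = r)"

text \<open>\<open>u t \<noteq> v t\<close> and \<open>R_fun p w \<noteq> 0\<close> are the only denominators whose nonvanishing does not
  already follow from positivity and interiority.\<close>

definition trajectory ::
  "params \<Rightarrow> real \<Rightarrow> (real \<Rightarrow> real) \<Rightarrow> (real \<Rightarrow> real) \<Rightarrow> (real \<Rightarrow> real)
     \<Rightarrow> (real \<Rightarrow> real) \<Rightarrow> (real \<Rightarrow> real) \<Rightarrow> bool" where
  "trajectory p s k h c u v \<longleftrightarrow>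
     (\<forall>t\<ge>s. let w = w_of (k t) (h t) (u t) (v t) in
        k t > 0 \<and> h t > 0 \<and> c t > 0 \<and>
        0 < u t \<and> u t < 1 \<and> 0 < v t \<and> v t < 1 \<and>
        u t \<noteq> v t \<and> R_fun p w \<noteq> 0 \<and>
        \<theta> p * w powr (\<psi>1 p - \<psi>2 p) = \<tau>_of (u t) (v t) powr (1 - \<psi>2 p) \<and>
        has_growth_rate k
          (A1 p * v t * (1 / w) * P1 p w powr (1 / \<psi>1 p) - c t / k t - \<delta>k p) t {s..} \<and>
        has_growth_rate h
          (A2 p * P2 p w powr (1 / \<psi>2 p) * (1 - u t) - \<delta>h p) t {s..} \<and>
        has_growth_rate c
          (1 / \<epsilon> p * (\<alpha>1 p * A1 p * w powr (\<psi>1 p - 1) * P1 p w powr (1 / \<psi>1 p - 1)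
                      - \<rho> p - \<delta>k p)) t {s..} \<and>
        has_growth_rate u
          ((D_fun p (u t) (v t) w + c t / k t + Q_fun p w * G2 p (v t) * P_fun p w / R_fun p w)
             * ((1 - u t) / (u t - v t))) t {s..} \<and>
        has_growth_rate v
          ((D_fun p (u t) (v t) w + c t / k t + Q_fun p w * G1 p (u t) * P_fun p w / R_fun p w)
             * ((1 - v t) / (u t - v t))) t {s..})"

text \<open>The five growth rates of a balanced growth path are a priori allowed to differ.\<close>

definition balanced_growth_path ::
  "params \<Rightarrow> real \<Rightarrow> (real \<Rightarrow> real) \<Rightarrow> (real \<Rightarrow> real) \<Rightarrow> (real \<Rightarrow> real)
     \<Rightarrow> (real \<Rightarrow> real) \<Rightarrow> (real \<Rightarrow> real) \<Rightarrow> bool" where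
  "balanced_growth_path p s k h c u v \<longleftrightarrow>
     trajectory p s k h c u v \<and>
     (\<exists>u0. \<forall>t\<ge>s. u t = u0) \<and> (\<exists>v0. \<forall>t\<ge>s. v t = v0) \<and>
     (\<exists>r. \<forall>t\<ge>s. has_growth_rate k r t {s..}) \<and>
     (\<exists>r. \<forall>t\<ge>s. has_growth_rate h r t {s..}) \<and>
     (\<exists>r. \<forall>t\<ge>s. has_growth_rate c r t {s..}) \<and>
     (\<exists>r. \<forall>t\<ge>s. has_growth_rate (\<lambda>t. y1 p (k t) (h t) (u t) (v t)) r t {s..}) \<and>
     (\<exists>r. \<forall>t\<ge>s. has_growth_rate (\<lambda>t. y2 p (k t) (h t) (u t) (v t)) r t {s..})"

end

theory Submission
  imports Defs "HOL-Analysis.Derivative"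
begin

text \<open>
  With \<open>u\<close> and \<open>v\<close> constant, the static optimality condition pins down \<open>w\<close> because
  \<open>\<psi>1 \<noteq> \<psi>2\<close>; hence \<open>k / h\<close> is constant, \<open>k\<close> and \<open>h\<close> share the constant growth rate of \<open>h\<close>, so
  \<open>c / k\<close> is constant and \<open>c\<close> shares it too.  Both brackets in the equations for \<open>u\<close> and \<open>v\<close>
  vanish, and their difference is a nonzero multiple of \<open>P\<close>, so \<open>P w = 0\<close>.  Since \<open>P\<close> is strictly
  decreasing, \<open>w\<close> is determined by the parameters, and then so are successively the growth rate,
  \<open>u\<close>, \<open>v\<close>, \<open>k / h\<close> and \<open>c / k\<close>, which leaves only the scale of the path free.
\<close>

section \<open>Growth rates\<close>

lemma has_growth_rate_iff:
  "has_growth_rate x r t S \<longleftrightarrow> x t \<noteq> 0 \<and> (x has_real_derivative r * x t) (at t within S)"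
  unfolding has_growth_rate_def by (auto simp: field_simps)

lemma has_growth_rate_subset:
  "has_growth_rate x r t S \<Longrightarrow> S' \<subseteq> S \<Longrightarrow> has_growth_rate x r t S'"
  unfolding has_growth_rate_iff by (auto intro: DERIV_subset)

text \<open>The half-lines may differ, so a rate along the full trajectory can be compared with one
  known only from a later time on. Both rates are restricted to the shorter half-line.\<close>

lemma has_growth_rate_unique:
  assumes "has_growth_rate x r t {a..}" "has_growth_rate x q t {b..}" "a \<le> b" "b \<le> t"
  shows "r = q"
proof -
  have "has_growth_rate x r t {b..}"
    using assms(1,3) by (auto intro: has_growth_rate_subset)
  \<comment> \<open>A derivative within a set is unique only at a limit point of it. Approach from
    the right suffices, which also covers \<open>t = b\<close>.\<close>
  moreover have "at t within {b..} \<noteq> bot"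
  proof -
    have "at t within {t..} \<le> at t within {b..}"
      using assms(4) by (intro at_le) auto
    moreover have "at t within {t..} \<noteq> bot"
      using trivial_limit_at_right_real[of t] by (simp add: at_within_Ici_at_right)
    ultimately show ?thesis by (auto simp: bot_unique)
  qed
  ultimately show ?thesis
    using assms(2) unfolding has_growth_rate_iff
    by (metis has_field_derivative_unique mult_right_cancel)
qed

lemma has_growth_rate_transform:
  assumes "has_growth_rate y r t {s..}" "s \<le> t" "\<And>t. t \<ge> s \<Longrightarrow> x t = y t"
  shows "has_growth_rate x r t {s..}"
  using assms unfolding has_growth_rate_iff
  by (auto intro: has_field_derivative_transform_within[where f = y and d = 1])

lemma has_growth_rate_cmult:
  "has_growth_rate x r t S \<Longrightarrow> a \<noteq> 0 \<Longrightarrow> has_growth_rate (\<lambda>t. a * x t) r t S"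
  unfolding has_growth_rate_iff by (auto intro!: derivative_eq_intros)

lemma has_growth_rate_mult:
  "has_growth_rate x r t S \<Longrightarrow> has_growth_rate y q t S \<Longrightarrow>
    has_growth_rate (\<lambda>t. x t * y t) (r + q) t S"
  unfolding has_growth_rate_iff by (auto intro!: derivative_eq_intros simp: algebra_simps)

lemma has_growth_rate_add:
  "has_growth_rate x r t S \<Longrightarrow> has_growth_rate y r t S \<Longrightarrow> x t + y t \<noteq> 0 \<Longrightarrow>
    has_growth_rate (\<lambda>t. x t + y t) r t S"
  unfolding has_growth_rate_iff by (auto intro!: derivative_eq_intros simp: algebra_simps)

lemma has_growth_rate_powr:
  assumes "has_growth_rate x r t S" "x t > 0"
  shows "has_growth_rate (\<lambda>t. x t powr a) (a * r) t S"
proof -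
  have "((\<lambda>t. x t powr a) has_real_derivative a * x t powr (a - 1) * (r * x t)) (at t within S)"
    using assms unfolding has_growth_rate_iff
    by (intro DERIV_chain2[where f = "\<lambda>y. y powr a"] has_real_derivative_powr) auto
  moreover have "x t powr (a - 1) * x t = x t powr a"
    using assms(2) by (simp add: powr_diff)
  ultimately show ?thesis
    using assms(2) unfolding has_growth_rate_iff by (simp add: mult_ac)
qed

text \<open>A CES aggregate is homogeneous of degree one: the inner sum grows at rate
  \<open>e * r\<close>, and the outer exponent \<open>1 / e\<close> restores
  \<open>r\<close>.\<close>

lemma has_growth_rate_CES:
  assumes x: "has_growth_rate x r t S" "x t > 0" and y: "has_growth_rate y r t S" "y t > 0"
    and ab: "a > 0" "b > 0" "A > 0" "e \<noteq> 0"
  shows "has_growth_rate (\<lambda>t. A * (a * x t powr e + b * y t powr e) powr (1 / e)) r t S"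
proof -
  have "has_growth_rate (\<lambda>t. a * x t powr e + b * y t powr e) (e * r) t S"
    using assms
    by (intro has_growth_rate_add has_growth_rate_cmult has_growth_rate_powr)
      (auto intro!: less_imp_neq[symmetric] add_pos_pos mult_pos_pos)
  moreover have "a * x t powr e + b * y t powr e > 0"
    using assms by (intro add_pos_pos mult_pos_pos) auto
  ultimately have "has_growth_rate (\<lambda>t. (a * x t powr e + b * y t powr e) powr (1 / e))
      (1 / e * (e * r)) t S"
    by (rule has_growth_rate_powr)
  then show ?thesis
    using ab has_growth_rate_cmult by fastforce
qed

lemma has_growth_rate_exp:
  assumes "\<And>t. t \<ge> s \<Longrightarrow> has_growth_rate x r t {s..}" "t \<ge> s"
  shows "x t = x s * exp (r * (t - s))"
proof -
  \<comment> \<open>Integrating factor for \<open>x' = r * x\<close>: the product has zero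
    derivative on a convex set.\<close>
  have "\<exists>d. \<forall>t\<in>{s..}. x t * exp (- r * t) = d"
  proof (rule has_field_derivative_zero_constant)
    fix t assume "t \<in> {s..}"
    then have "(x has_real_derivative r * x t) (at t within {s..})"
      using assms(1) by (auto simp: has_growth_rate_iff)
    then show "((\<lambda>t. x t * exp (- r * t)) has_real_derivative 0) (at t within {s..})"
      by (auto intro!: derivative_eq_intros simp: algebra_simps)
  qed auto
  then have "x t * exp (- r * t) = x s * exp (- r * s)"
    using assms(2) by (metis atLeast_iff order_refl)
  then show ?thesis
    by (simp add: exp_minus exp_diff right_diff_distrib field_simps)
qed

lemma has_growth_rate_0_const:
  assumes "\<And>t. t \<ge> s \<Longrightarrow> has_growth_rate x 0 t {s..}" "t \<ge> s"
  shows "x t = x s"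
  using has_growth_rate_exp[OF assms] by simp

section \<open>Uniqueness of the factor ratio\<close>

text \<open>Since \<open>e\<close> and \<open>q\<close> have the same sign, the map is a composition
  of two increasing or of two decreasing powers. This handles either sign of the substitution
  parameters at once.\<close>

lemma powr_sum_powr_strict_mono:
  fixes x y a b e q :: real
  assumes "0 < x" "x < y" "0 < b" "0 \<le> a" "0 < e * q"
  shows "(b * x powr e + a) powr q < (b * y powr e + a) powr q"
proof -
  have pos: "b * z powr e + a > 0" if "z > 0" for z
    using that assms by (intro add_pos_nonneg mult_pos_pos) auto
  consider "0 < e" "0 < q" | "e < 0" "q < 0"
    using assms(5) by (auto simp: zero_less_mult_iff)
  then show ?thesis
  proof cases
    case 1
    then have "x powr e < y powr e"
      using assms by (intro powr_less_mono2) auto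
    then show ?thesis
      using 1 assms pos[of x] by (intro powr_less_mono2) auto
  next
    case 2
    then have "y powr e < x powr e"
      using assms by (intro powr_less_mono2_neg) auto
    then show ?thesis
      using 2 assms pos[of y] by (intro powr_less_mono2_neg) auto
  qed
qed

lemma \<theta>_pos: "valid_params p \<Longrightarrow> \<theta> p > 0"
  by (simp add: valid_params_def \<theta>_def)

lemma P1_pos: "valid_params p \<Longrightarrow> w > 0 \<Longrightarrow> P1 p w > 0"
  unfolding valid_params_def P1_def by (simp add: add_pos_pos add_diff_eq[symmetric])

lemma P2_pos: "valid_params p \<Longrightarrow> w > 0 \<Longrightarrow> P2 p w > 0"
  using \<theta>_pos[of p] unfolding valid_params_def P2_def
  by (simp add: add_pos_pos add_diff_eq[symmetric])

text \<open>Absorbing the outer power of \<open>w\<close> leaves \<open>w\<close> in a single place,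
  as \<open>1 / w\<close>, so that \<open>powr_sum_powr_strict_mono\<close> applies.\<close>

lemma P1_powr_eq:
  assumes "valid_params p" "w > 0"
  shows "w powr (\<psi>1 p - 1) * P1 p w powr (1 / \<psi>1 p - 1)
    = ((1 - \<alpha>1 p) * (1 / w) powr \<psi>1 p + \<alpha>1 p) powr (1 / \<psi>1 p - 1)"
proof -
  have "\<psi>1 p \<noteq> 0"
    using assms by (simp add: valid_params_def)
  then have "w powr (\<psi>1 p - 1) = ((1 / w) powr \<psi>1 p) powr (1 / \<psi>1 p - 1)"
    using assms(2) by (simp add: powr_divide powr_powr right_diff_distrib powr_diff)
  then have "w powr (\<psi>1 p - 1) * P1 p w powr (1 / \<psi>1 p - 1)
      = ((1 / w) powr \<psi>1 p * P1 p w) powr (1 / \<psi>1 p - 1)"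
    using P1_pos[OF assms] by (simp add: powr_mult)
  also have "(1 / w) powr \<psi>1 p * P1 p w = (1 - \<alpha>1 p) * (1 / w) powr \<psi>1 p + \<alpha>1 p"
    using assms(2) by (simp add: P1_def powr_divide field_simps)
  finally show ?thesis .
qed

text \<open>The first term increases in \<open>1 / w\<close>, and the subtracted \<open>P2\<close>
  term increases in \<open>w\<close>. In both, inner and outer exponent multiply to
  \<open>1 - \<psi>1 p > 0\<close>.\<close>

lemma P_fun_strict_antimono:
  assumes "valid_params p" "0 < w" "w < w'"
  shows "P_fun p w' < P_fun p w"
proof -
  note par = assms(1)[unfolded valid_params_def]
  have "w' powr (\<psi>1 p - 1) * P1 p w' powr (1 / \<psi>1 p - 1)
      < w powr (\<psi>1 p - 1) * P1 p w powr (1 / \<psi>1 p - 1)"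
  proof -
    have "\<psi>1 p * (1 / \<psi>1 p - 1) = 1 - \<psi>1 p"
      using par by (simp add: right_diff_distrib)
    then show ?thesis
      using assms par by (auto simp: P1_powr_eq frac_less2 intro!: powr_sum_powr_strict_mono)
  qed
  moreover have "P2 p w powr (1 / \<psi>2 p - 1) < P2 p w' powr (1 / \<psi>2 p - 1)"
  proof -
    have "\<psi>2 p * (1 - \<psi>1 p) / (1 - \<psi>2 p) * (1 / \<psi>2 p - 1) = 1 - \<psi>1 p"
      using par by (simp add: field_simps)
    then show ?thesis
      using assms par \<theta>_pos[of p] unfolding P2_def add_diff_eq[symmetric]
      by (intro powr_sum_powr_strict_mono) auto
  qed
  ultimately show ?thesis
    using par unfolding P_fun_def mult.assoc
    by (smt (verit, best) mult_pos_pos mult_strict_left_mono)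
qed

lemma P_fun_zero_unique:
  "valid_params p \<Longrightarrow> w > 0 \<Longrightarrow> w' > 0 \<Longrightarrow> P_fun p w = 0 \<Longrightarrow> P_fun p w' = 0 \<Longrightarrow> w = w'"
  by (metis P_fun_strict_antimono less_irrefl linorder_neqE_linordered_idom)

section \<open>Trajectories with constant fractions\<close>

lemma trajectory_later:
  assumes "trajectory p s k h c u v" "s \<le> s'"
  shows "trajectory p s' k h c u v"
proof -
  have "{s'..} \<subseteq> {s..}"
    using assms(2) by auto
  then show ?thesis
    using assms unfolding trajectory_def Let_def
    by (auto intro: has_growth_rate_subset order_trans)
qed

text \<open>Covers both the tail of the given trajectory and an arbitrary balanced growth path, so
  that the two can be compared.\<close>

locale steady_trajectory =
  fixes p :: params and s :: real and k h c u v :: "real \<Rightarrow> real"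
  assumes valid: "valid_params p"
    and traj: "trajectory p s k h c u v"
    and u_rate: "\<And>t. t \<ge> s \<Longrightarrow> has_growth_rate u 0 t {s..}"
    and v_rate: "\<And>t. t \<ge> s \<Longrightarrow> has_growth_rate v 0 t {s..}"
begin

definition w0 :: real where
  "w0 = w_of (k s) (h s) (u s) (v s)"

definition r0 :: real where
  "r0 = 1 / \<epsilon> p * (\<alpha>1 p * A1 p * w0 powr (\<psi>1 p - 1) * P1 p w0 powr (1 / \<psi>1 p - 1) - \<rho> p - \<delta>k p)"

lemmas par = valid[unfolded valid_params_def]

lemma positive:
  assumes "t \<ge> s"
  shows "k t > 0" "h t > 0" "c t > 0" "0 < u t" "u t < 1" "0 < v t" "v t < 1" "u t \<noteq> v t"
  using traj assms unfolding trajectory_def Let_def by auto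

lemma u_const: "t \<ge> s \<Longrightarrow> u t = u s"
  using u_rate by (rule has_growth_rate_0_const)

lemma v_const: "t \<ge> s \<Longrightarrow> v t = v s"
  using v_rate by (rule has_growth_rate_0_const)

section \<open>Constancy of the factor ratio\<close>

lemma w_pos: "t \<ge> s \<Longrightarrow> w_of (k t) (h t) (u t) (v t) > 0"
  using positive by (simp add: w_of_def)

lemma static_optimality:
  "t \<ge> s \<Longrightarrow> \<theta> p * w_of (k t) (h t) (u t) (v t) powr (\<psi>1 p - \<psi>2 p)
    = \<tau>_of (u s) (v s) powr (1 - \<psi>2 p)"
  using traj u_const v_const unfolding trajectory_def Let_def by metis

lemma w_const:
  assumes "t \<ge> s"
  shows "w_of (k t) (h t) (u t) (v t) = w0"
proof -
  have "w_of (k t) (h t) (u t) (v t) powr (\<psi>1 p - \<psi>2 p) = w0 powr (\<psi>1 p - \<psi>2 p)"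
    using static_optimality[OF assms] static_optimality[OF order_refl] \<theta>_pos[OF valid]
    unfolding w0_def by (metis mult_left_cancel less_irrefl)
  \<comment> \<open>The power is injective on positive reals because its exponent is nonzero; the
    reciprocal exponent undoes it.\<close>
  then have "(w_of (k t) (h t) (u t) (v t) powr (\<psi>1 p - \<psi>2 p)) powr (1 / (\<psi>1 p - \<psi>2 p))
      = (w0 powr (\<psi>1 p - \<psi>2 p)) powr (1 / (\<psi>1 p - \<psi>2 p))"
    by simp
  then show ?thesis
    using w_pos[OF assms] w_pos[OF order_refl] par by (simp add: powr_powr w0_def)
qed

lemma w0_pos: "w0 > 0"
  unfolding w0_def by (rule w_pos) simp

section \<open>The common growth rate of both capitals and consumption\<close>

lemma k_eq: "t \<ge> s \<Longrightarrow> k t = w0 * u s / v s * h t"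
  using w_const[of t] u_const[of t] v_const[of t] positive[of t] by (auto simp: w_of_def field_simps)

lemma h_rate:
  "t \<ge> s \<Longrightarrow> has_growth_rate h (A2 p * P2 p w0 powr (1 / \<psi>2 p) * (1 - u s) - \<delta>h p) t {s..}"
  using traj w_const[of t] u_const[of t] unfolding trajectory_def Let_def by metis

lemma c_rate: "t \<ge> s \<Longrightarrow> has_growth_rate c r0 t {s..}"
  using traj w_const[of t] unfolding trajectory_def Let_def r0_def by metis

lemma k_rate_traj:
  "t \<ge> s \<Longrightarrow> has_growth_rate k
    (A1 p * v s * (1 / w0) * P1 p w0 powr (1 / \<psi>1 p) - c t / k t - \<delta>k p) t {s..}"
  using traj w_const[of t] v_const[of t] unfolding trajectory_def Let_def by metis

lemma k_rate:
  assumes "t \<ge> s"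
  shows "has_growth_rate k (A2 p * P2 p w0 powr (1 / \<psi>2 p) * (1 - u s) - \<delta>h p) t {s..}"
proof (rule has_growth_rate_transform)
  show "has_growth_rate (\<lambda>t. w0 * u s / v s * h t)
      (A2 p * P2 p w0 powr (1 / \<psi>2 p) * (1 - u s) - \<delta>h p) t {s..}"
    using h_rate[OF assms] w0_pos positive[of s] by (intro has_growth_rate_cmult) auto
qed (use assms k_eq in auto)

text \<open>Equates two growth rates of \<open>k\<close>: that of its own differential equation,
  which contains \<open>c t / k t\<close>, and that inherited from \<open>h\<close>.\<close>

lemma c_eq:
  assumes "t \<ge> s"
  shows "c t = (A1 p * v s * (1 / w0) * P1 p w0 powr (1 / \<psi>1 p) - \<delta>k p
    - (A2 p * P2 p w0 powr (1 / \<psi>2 p) * (1 - u s) - \<delta>h p)) * k t"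
  using has_growth_rate_unique[OF k_rate_traj[OF assms] k_rate[OF assms]] assms positive[of t]
  by (simp add: field_simps)

text \<open>Consumption has rate \<open>r0\<close> by its own equation, and the rate of
  \<open>k\<close> because it is a nonzero constant multiple of \<open>k\<close>.\<close>

lemma r0_eq: "r0 = A2 p * P2 p w0 powr (1 / \<psi>2 p) * (1 - u s) - \<delta>h p"
proof -
  define b where "b = A1 p * v s * (1 / w0) * P1 p w0 powr (1 / \<psi>1 p) - \<delta>k p
    - (A2 p * P2 p w0 powr (1 / \<psi>2 p) * (1 - u s) - \<delta>h p)"
  have c: "c t = b * k t" if "t \<ge> s" for t
    using c_eq[OF that] by (simp add: b_def)
  have "b \<noteq> 0"
    using c[of s] positive[of s] by auto
  then have "has_growth_rate c (A2 p * P2 p w0 powr (1 / \<psi>2 p) * (1 - u s) - \<delta>h p) s {s..}"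
    using c by (intro has_growth_rate_transform[OF has_growth_rate_cmult[OF k_rate]]) auto
  with c_rate[of s] show ?thesis
    by (auto intro: has_growth_rate_unique)
qed

lemmas rates = h_rate[folded r0_eq] k_rate[folded r0_eq] c_rate

lemma c_proportional_k:
  "t \<ge> s \<Longrightarrow> c t = (A1 p * v s * (1 / w0) * P1 p w0 powr (1 / \<psi>1 p) - \<delta>k p - r0) * k t"
  using c_eq by (simp add: r0_eq)

text \<open>The brackets in the equations for \<open>u\<close> and \<open>v\<close> vanish, as their
  cofactors are nonzero at interior fractions. They share the term \<open>E\<close>, so subtracting
  leaves \<open>F * (\<psi>1 p - \<psi>2 p) * (v s - u s) = 0\<close>, where \<open>F\<close> is a
  nonzero multiple of \<open>P_fun p w0\<close>.\<close>

lemma P_fun_w0: "P_fun p w0 = 0"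
proof -
  define E where "E = D_fun p (u s) (v s) w0 + c s / k s"
  define F where "F = Q_fun p w0 * P_fun p w0 / R_fun p w0"
  have rates: "has_growth_rate u ((E + F * G2 p (v s)) * ((1 - u s) / (u s - v s))) s {s..}"
    "has_growth_rate v ((E + F * G1 p (u s)) * ((1 - v s) / (u s - v s))) s {s..}"
    and R: "R_fun p w0 \<noteq> 0"
    using traj w0_def unfolding trajectory_def Let_def E_def F_def by (auto simp: mult_ac)
  have "E + F * G2 p (v s) = 0" "E + F * G1 p (u s) = 0"
    using has_growth_rate_unique[OF rates(1) u_rate[of s]]
      has_growth_rate_unique[OF rates(2) v_rate[of s]] positive[of s] by auto
  then have "F * (G2 p (v s) - G1 p (u s)) = 0"
    by (simp only: right_diff_distrib)
  moreover have "G2 p (v s) - G1 p (u s) = (\<psi>1 p - \<psi>2 p) * (v s - u s)"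
    by (simp add: G1_def G2_def algebra_simps)
  ultimately have "F = 0"
    using par positive[of s] by auto
  moreover have "Q_fun p w0 \<noteq> 0"
    using P1_pos[OF valid w0_pos] P2_pos[OF valid w0_pos] by (simp add: Q_fun_def)
  ultimately show ?thesis
    using R by (simp add: F_def)
qed

section \<open>Closed forms for the fractions and the consumption ratio\<close>

lemma u_eq: "u s = 1 - (r0 + \<delta>h p) / (A2 p * P2 p w0 powr (1 / \<psi>2 p))"
  using par P2_pos[OF valid w0_pos] by (simp add: r0_eq)

lemma \<tau>_eq: "\<tau>_of (u s) (v s) = w0 powr ((\<psi>1 p - \<psi>2 p) / (1 - \<psi>2 p)) * \<theta> p powr (1 / (1 - \<psi>2 p))"
proof -
  have "\<tau>_of (u s) (v s) > 0"
    using positive[of s] by (simp add: \<tau>_of_def)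
  then have "\<tau>_of (u s) (v s) = (\<tau>_of (u s) (v s) powr (1 - \<psi>2 p)) powr (1 / (1 - \<psi>2 p))"
    using par by (simp add: powr_powr)
  also have "\<dots> = (\<theta> p * w0 powr (\<psi>1 p - \<psi>2 p)) powr (1 / (1 - \<psi>2 p))"
    using static_optimality[of s] by (simp add: w0_def)
  also have "\<dots> = w0 powr ((\<psi>1 p - \<psi>2 p) / (1 - \<psi>2 p)) * \<theta> p powr (1 / (1 - \<psi>2 p))"
    using \<theta>_pos[OF valid] w0_pos by (simp add: powr_mult powr_powr)
  finally show ?thesis .
qed

text \<open>Inverts the definition of \<open>\<tau>_of\<close> for \<open>v\<close>; the denominator
  equals \<open>(1 - u s) / (1 - v s)\<close>, hence is positive.\<close>

lemma v_eq: "v s = \<tau>_of (u s) (v s) * u s / (1 + (\<tau>_of (u s) (v s) - 1) * u s)"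
proof -
  have "\<tau>_of (u s) (v s) * u s = v s * (1 - u s) / (1 - v s)"
    using positive[of s] by (simp add: \<tau>_of_def)
  moreover from this have "1 + (\<tau>_of (u s) (v s) - 1) * u s = (1 - u s) / (1 - v s)"
    using positive[of s] by (simp add: left_diff_distrib field_simps)
  ultimately show ?thesis
    using positive[of s] by simp
qed

lemma c_div_k_eq:
  "c s / k s = 1 / \<epsilon> p * (A1 p * (1 / w0)
      * (\<alpha>1 p * (\<epsilon> p * v s - 1) * w0 powr \<psi>1 p + \<epsilon> p * (1 - \<alpha>1 p) * v s)
      * P1 p w0 powr (1 / \<psi>1 p - 1) + \<rho> p - \<delta>k p * (\<epsilon> p - 1))"
proof -
  \<comment> \<open>In terms of \<open>X\<close> and \<open>W\<close> every real power disappears,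
    and the claim becomes a rational identity.\<close>
  define X where "X = P1 p w0 powr (1 / \<psi>1 p - 1)"
  define W where "W = w0 powr \<psi>1 p"
  have X: "P1 p w0 powr (1 / \<psi>1 p) = X * P1 p w0"
    using P1_pos[OF valid w0_pos] by (simp add: X_def powr_diff)
  have W: "w0 powr (\<psi>1 p - 1) = W / w0"
    using w0_pos by (simp add: W_def powr_diff)
  have "\<epsilon> p \<noteq> 0"
    using par by auto
  have cdk: "c s / k s = A1 p * v s * (1 / w0) * P1 p w0 powr (1 / \<psi>1 p) - \<delta>k p - r0"
    using c_proportional_k[of s] positive[of s] by simp
  show ?thesis
    using w0_pos \<open>\<epsilon> p \<noteq> 0\<close> unfolding cdk r0_def X W X_def[symmetric] unfolding P1_def W_def[symmetric]
    by (simp add: divide_simps) (simp add: algebra_simps)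
qed

lemma h_exp: "t \<ge> s \<Longrightarrow> h t = h s * exp (r0 * (t - s))"
  using rates(1) by (rule has_growth_rate_exp)

end

section \<open>Growth of the outputs, and uniqueness up to scale\<close>

lemma has_growth_rate_y1_y2:
  assumes "valid_params p" "k t > 0" "h t > 0" "0 < u t" "u t < 1" "0 < v t" "v t < 1"
    and k: "has_growth_rate k r t S" and h: "has_growth_rate h r t S"
    and u: "has_growth_rate u 0 t S" and v: "has_growth_rate v 0 t S"
  shows "has_growth_rate (\<lambda>t. y1 p (k t) (h t) (u t) (v t)) r t S"
    and "has_growth_rate (\<lambda>t. y2 p (k t) (h t) (u t) (v t)) r t S"
proof -
  have u': "has_growth_rate (\<lambda>t. 1 - u t) 0 t S" and v': "has_growth_rate (\<lambda>t. 1 - v t) 0 t S"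
    using assms unfolding has_growth_rate_iff by (auto intro!: derivative_eq_intros)
  have "has_growth_rate (\<lambda>t. k t * v t) r t S" "has_growth_rate (\<lambda>t. h t * u t) r t S"
    using has_growth_rate_mult[OF k v] has_growth_rate_mult[OF h u] by simp_all
  then show "has_growth_rate (\<lambda>t. y1 p (k t) (h t) (u t) (v t)) r t S"
    unfolding y1_def using assms(1-7)
    by (intro has_growth_rate_CES) (simp_all add: valid_params_def)
  have "has_growth_rate (\<lambda>t. k t * (1 - v t)) r t S" "has_growth_rate (\<lambda>t. h t * (1 - u t)) r t S"
    using has_growth_rate_mult[OF k v'] has_growth_rate_mult[OF h u'] by simp_all
  then show "has_growth_rate (\<lambda>t. y2 p (k t) (h t) (u t) (v t)) r t S"
    unfolding y2_def using assms(1-7)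
    by (intro has_growth_rate_CES) (simp_all add: valid_params_def)
qed

text \<open>The parameters determine in turn \<open>w0\<close>, \<open>r0\<close>, \<open>u\<close>
  and \<open>v\<close>. Then \<open>h\<close> is exponential with known rate, and \<open>k\<close>
  and \<open>c\<close> are fixed multiples of it, so only the initial level of \<open>h\<close> is
  free. Paths are compared at equal elapsed time \<open>x\<close>, since their starting times may
  differ.\<close>

lemma steady_trajectory_proportional:
  assumes "steady_trajectory p s k h c u v" "steady_trajectory p s' k' h' c' u' v'" "x \<ge> 0"
  shows "k' (s' + x) = h' s' / h s * k (s + x)" "h' (s' + x) = h' s' / h s * h (s + x)"
    "c' (s' + x) = h' s' / h s * c (s + x)" "u' (s' + x) = u (s + x)" "v' (s' + x) = v (s + x)"
proof -
  interpret A: steady_trajectory p s k h c u v by fact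
  interpret B: steady_trajectory p s' k' h' c' u' v' by fact
  have w: "B.w0 = A.w0"
    using P_fun_zero_unique A.valid A.w0_pos B.w0_pos A.P_fun_w0 B.P_fun_w0 by blast
  then have r: "B.r0 = A.r0"
    by (simp add: A.r0_def B.r0_def)
  have u: "u' s' = u s"
    using A.u_eq B.u_eq by (simp add: w r)
  have v: "v' s' = v s"
    using A.v_eq[unfolded A.\<tau>_eq] B.v_eq[unfolded B.\<tau>_eq] by (simp add: w u)
  show "u' (s' + x) = u (s + x)" "v' (s' + x) = v (s + x)"
    using A.u_const[of "s + x"] B.u_const[of "s' + x"] A.v_const[of "s + x"] B.v_const[of "s' + x"]
      assms(3) u v by auto
  show h: "h' (s' + x) = h' s' / h s * h (s + x)"
    using A.h_exp[of "s + x"] B.h_exp[of "s' + x"] A.positive[of s] assms(3) by (simp add: r)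
  show k: "k' (s' + x) = h' s' / h s * k (s + x)"
    using A.k_eq[of "s + x"] B.k_eq[of "s' + x"] assms(3) by (simp add: h w u v mult_ac)
  show "c' (s' + x) = h' s' / h s * c (s + x)"
    using A.c_proportional_k[of "s + x"] B.c_proportional_k[of "s' + x"] assms(3) by (simp add: k w r v)
qed

lemma balanced_growth_path_steady:
  assumes "valid_params p" "balanced_growth_path p s k h c u v"
  shows "steady_trajectory p s k h c u v"
proof
  show "trajectory p s k h c u v"
    using assms(2) by (simp add: balanced_growth_path_def)
  then have uv: "u t \<noteq> 0 \<and> v t \<noteq> 0" if "t \<ge> s" for t
    using that by (fastforce simp: trajectory_def Let_def)
  \<comment> \<open>Constancy gives rate zero only for a nonzero value, as growth rates are
    undefined at zeros; interiority supplies this for \<open>u\<close> and \<open>v\<close>.\<close>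
  have const: "has_growth_rate x 0 t {s..}"
    if x: "\<exists>a. \<forall>t\<ge>s. x t = a" "x t \<noteq> 0" "t \<ge> s" for x :: "real \<Rightarrow> real" and t
  proof -
    obtain a where "\<forall>t\<ge>s. x t = a" using x(1) by auto
    moreover from this have "a \<noteq> 0" using x by auto
    then have "has_growth_rate (\<lambda>_. a) 0 t {s..}"
      by (simp add: has_growth_rate_iff)
    ultimately show ?thesis
      using x(3) by (metis has_growth_rate_transform)
  qed
  show "has_growth_rate u 0 t {s..}" "has_growth_rate v 0 t {s..}" if "t \<ge> s" for t
    using assms(2) uv that by (auto simp: balanced_growth_path_def intro!: const)
qed (fact assms)

theorem proposition1:
  fixes p :: params and k h c u v :: "real \<Rightarrow> real" and t_star :: real
  defines "u_star \<equiv> u t_star"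
    and "v_star \<equiv> v t_star"
    and "w_star \<equiv> w_of (k t_star) (h t_star) (u t_star) (v t_star)"
    and "c_star \<equiv> c t_star"
    and "k_star \<equiv> k t_star"
  defines "r_star \<equiv> 1 / \<epsilon> p * (\<alpha>1 p * A1 p * w_star powr (\<psi>1 p - 1)
                        * P1 p w_star powr (1 / \<psi>1 p - 1) - \<rho> p - \<delta>k p)"
    and "\<tau>0 \<equiv> w_star powr ((\<psi>1 p - \<psi>2 p) / (1 - \<psi>2 p)) * \<theta> p powr (1 / (1 - \<psi>2 p))"
    and "P\<epsilon> \<equiv> \<alpha>1 p * (\<epsilon> p * v_star - 1) * w_star powr \<psi>1 p
                + \<epsilon> p * (1 - \<alpha>1 p) * v_star"
  assumes "valid_params p"
    and "trajectory p 0 k h c u v"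
    and "t_star \<ge> 0"
    and "\<forall>t\<ge>t_star. has_growth_rate u 0 t {0..} \<and> has_growth_rate v 0 t {0..}"
  shows
    "balanced_growth_path p t_star k h c u v \<and>
     (\<forall>s k' h' c' u' v'. balanced_growth_path p s k' h' c' u' v' \<longrightarrow>
        (\<exists>l>0. \<forall>x\<ge>0.
           k' (s + x) = l * k (t_star + x) \<and>
           h' (s + x) = l * h (t_star + x) \<and>
           c' (s + x) = l * c (t_star + x) \<and>
           u' (s + x) = u (t_star + x) \<and>
           v' (s + x) = v (t_star + x))) \<and>
     (\<forall>t\<ge>t_star.
        has_growth_rate k r_star t {0..} \<and>
        has_growth_rate h r_star t {0..} \<and>
        has_growth_rate c r_star t {0..} \<and>
        has_growth_rate (\<lambda>t. y1 p (k t) (h t) (u t) (v t)) r_star t {0..} \<and>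
        has_growth_rate (\<lambda>t. y2 p (k t) (h t) (u t) (v t)) r_star t {0..}) \<and>
     w_star > 0 \<and> P_fun p w_star = 0 \<and> (\<forall>w>0. P_fun p w = 0 \<longrightarrow> w = w_star) \<and>
     u_star \<in> {0..1} \<and> v_star \<in> {0..1} \<and>
     u_star = 1 - (r_star + \<delta>h p) / (A2 p * P2 p w_star powr (1 / \<psi>2 p)) \<and>
     v_star = \<tau>0 * u_star / (1 + (\<tau>0 - 1) * u_star) \<and>
     c_star / k_star =
       1 / \<epsilon> p * (A1 p * (1 / w_star) * P\<epsilon> * P1 p w_star powr (1 / \<psi>1 p - 1)
                  + \<rho> p - \<delta>k p * (\<epsilon> p - 1))"
proof -
  note t_star = \<open>t_star \<ge> 0\<close>
  have sub: "{t_star..} \<subseteq> {0..}"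
    using t_star by auto
  interpret S: steady_trajectory p t_star k h c u v
    using assms trajectory_later has_growth_rate_subset[OF _ sub] by unfold_locales auto
  have w: "w_star = S.w0"
    by (simp add: w_star_def S.w0_def)
  have r: "r_star = S.r0"
    by (simp add: r_star_def S.r0_def w)
  \<comment> \<open>The rate \<open>q\<close> exists on the original time domain, and comparison on
    the later half-line identifies it. This matters at \<open>t = t_star\<close>, where the
    derivative within \<open>{t_star..}\<close> is only one-sided.\<close>
  have rate: "has_growth_rate x r_star t {0..}"
    if "has_growth_rate x q t {0..}" "has_growth_rate x S.r0 t {t_star..}" "t \<ge> t_star" for x q t
    using has_growth_rate_unique[OF that(1,2)] that t_star by (simp add: r)
  have growth: "has_growth_rate k r_star t {0..} \<and> has_growth_rate h r_star t {0..} \<and>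
      has_growth_rate c r_star t {0..} \<and>
      has_growth_rate (\<lambda>t. y1 p (k t) (h t) (u t) (v t)) r_star t {0..} \<and>
      has_growth_rate (\<lambda>t. y2 p (k t) (h t) (u t) (v t)) r_star t {0..}"
    if t: "t \<ge> t_star" for t
  proof -
    have "\<exists>q. has_growth_rate k q t {0..}" "\<exists>q. has_growth_rate h q t {0..}"
      "\<exists>q. has_growth_rate c q t {0..}"
      using \<open>trajectory p 0 k h c u v\<close> t t_star unfolding trajectory_def Let_def
      by (meson order_trans)+
    then have "has_growth_rate k r_star t {0..}" "has_growth_rate h r_star t {0..}"
      "has_growth_rate c r_star t {0..}"
      using rate S.rates t by blast+
    then show ?thesis
      using has_growth_rate_y1_y2[of p k t h u v r_star "{0..}"] S.positive[OF t] S.valid assms t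
      by auto
  qed
  have "balanced_growth_path p t_star k h c u v"
    unfolding balanced_growth_path_def
    using S.traj S.u_const S.v_const growth has_growth_rate_subset[OF _ sub] by blast
  moreover have "\<exists>l>0. \<forall>x\<ge>0. k' (s + x) = l * k (t_star + x) \<and> h' (s + x) = l * h (t_star + x) \<and>
      c' (s + x) = l * c (t_star + x) \<and> u' (s + x) = u (t_star + x) \<and> v' (s + x) = v (t_star + x)"
    if "balanced_growth_path p s k' h' c' u' v'" for s k' h' c' u' v'
  proof -
    interpret B: steady_trajectory p s k' h' c' u' v'
      using S.valid that by (rule balanced_growth_path_steady)
    \<comment> \<open>This ratio of initial human capital is the scale factor
      \<open>l\<close>.\<close>
    have "h' s / h t_star > 0"
      using S.positive[of t_star] B.positive[of s] by simp
    then show ?thesis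
      using steady_trajectory_proportional[OF S.steady_trajectory_axioms B.steady_trajectory_axioms]
      by blast
  qed
  moreover have "u_star \<in> {0..1}" "v_star \<in> {0..1}"
    using S.positive[of t_star] by (auto simp: u_star_def v_star_def)
  moreover have "\<forall>w>0. P_fun p w = 0 \<longrightarrow> w = w_star"
    using P_fun_zero_unique S.valid S.w0_pos S.P_fun_w0 w by blast
  moreover have "u_star = 1 - (r_star + \<delta>h p) / (A2 p * P2 p w_star powr (1 / \<psi>2 p))"
    using S.u_eq by (simp add: u_star_def w r)
  moreover have "v_star = \<tau>0 * u_star / (1 + (\<tau>0 - 1) * u_star)"
    using S.v_eq unfolding S.\<tau>_eq by (simp add: u_star_def v_star_def \<tau>0_def w)
  moreover have "c_star / k_star = 1 / \<epsilon> p * (A1 p * (1 / w_star) * P\<epsilon> * P1 p w_star powr (1 / \<psi>1 p - 1)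
      + \<rho> p - \<delta>k p * (\<epsilon> p - 1))"
    using S.c_div_k_eq by (simp add: c_star_def k_star_def P\<epsilon>_def v_star_def w)
  ultimately show ?thesis
    using growth S.w0_pos S.P_fun_w0 unfolding w by blast
qed

end
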